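(* Let $K$ be a CW 2-pseudomanifold whose 2-cells are simple polygons, let $\cup$ be the polygonal cup product on real-valued cochains of $K$, and let $d$ be the discrete exterior derivative (coboundary operator). Then $\cup$ satisfies the Leibniz rule with $d$, that is: $$d_0(\alpha\cup\beta) = d_0\alpha\cup\beta + \alpha\cup d_0\beta \quad\text{for all } \alpha,\beta\in C^0(K,\mathbb{R}),$$ $$d_1(\alpha\cup\beta) = d_0\alpha\cup\beta + \alpha\cup d_1\beta \quad\text{for all } \alpha\in C^0(K,\mathbb{R}),\ \beta\in C^1(K,\mathbb{R}),$$ and $d(\alpha\cup\beta)=0$ whenever $\alpha\in C^0(K,\mathbb{R}),\beta\in C^2(K,\mathbb{R})$ or $\alpha,\beta\in C^1(K,\mathbb{R})$.
   Context: **Pseudomanifold.** A finite regular CW complex is a CW complex with finitely many cells whose characteristic maps can be taken to be homeomorphisms onto the closed cells and such that the boundary of each cell is a union of open cells. A cell $e$ is a face of a cell $e'$ if $e$ is contained in the closure of $e'$. A CW $n$-pseudomanifold is an $n$-dimensional finite regular CW complex such that (1) every cell is a face of some $n$-cell; (2) every $(n-1)$-cell is a face of at most two $n$-cells; (3) any two $n$-cells $a,b$ are joined by a sequence of $n$-cells $a=e_0,\dots,e_k=b$ in which consecutive cells have a common $(n-1)$-dimensional face. Here $n=2$, and the 2-cells are simple polygons: each oriented 2-cell (face) is written $f=(v_0,\dots,v_{p-1})$, where $p\ge 3$ and $v_0,\dots,v_{p-1}$ are its distinct vertices in cyclic order, and its boundary consists of the oriented edges $e_i=(v_i,v_{i+1})$,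 $0\le i\le p-1$, indices modulo $p$. The number $p$ may vary from face to face. **Chains and cochains.** $C_q(K)$ is the group of integer $q$-chains on oriented $q$-cells (reversing the orientation of a cell changes the sign), which is trivial for $q<0$ and $q>2$. The boundary is $\partial(v_i,v_j)=v_j-v_i$ on edges and $\partial f=\sum_{i=0}^{p-1}e_i$ on faces. Real-valued discrete $q$-forms are the elements of $C^q(K,\mathbb{R})=\mathrm{Hom}(C_q(K),\mathbb{R})$. The discrete exterior derivative $d_q:C^q(K,\mathbb{R})\to C^{q+1}(K,\mathbb{R})$ is the coboundary operator, $(d_q\alpha)(c)=\alpha(\partial c)$ for $c\in C_{q+1}(K)$. **Polygonal cup product** $\cup:C^k(K,\mathbb{R})\times C^l(K,\mathbb{R})\to C^{k+l}(K,\mathbb{R})$. Superscripts denote degrees of forms. For a vertex $v$, an edge $e=(v_i,v_j)$, and a face $f=(v_0,\dots,v_{p-1})$ with edges $e_i=(v_i,v_{i+1})$ (indices modulo $p$): $$(\alpha^0\cup\beta^0)(v)=\alpha(v)\beta(v),$$ $$(\alpha^0\cup\beta^1)(e)=\tfrac12(\alpha(v_i)+\alpha(v_j))\,\beta(e),$$ $$(\alpha^0\cup\beta^2)(f)=\tfrac1p\Big(\sum_{i=0}^{p-1}\alpha(v_i)\Big)\beta(f),$$ $$(\alpha^1\cup\beta^1)(f)=\sum_{i=0}^{p-1}\alpha(e_i)\sum_{a=1}^{\lfloor (p-1)/2\rfloor}\Big(\tfrac12-\tfrac ap\Big)\big(\beta(e_{i+a})-\beta(e_{i-a})\big).$$ The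 products of a 1-form or a 2-form with a 0-form on the right are given by the same expressions: $\beta^1\cup\alpha^0=\alpha^0\cup\beta^1$ and $\beta^2\cup\alpha^0=\alpha^0\cup\beta^2$. Products of total degree greater than 2 are $0$. *)

theory Defs
  imports "HOL-Analysis.Abstract_Euclidean_Space" "HOL-Algebra.Free_Abelian_Groups"
begin

section \<open>Finite regular CW complexes and pseudomanifolds\<close>

text \<open>\<open>Euclidean_space n\<close> consists of the sequences of reals that vanish from index \<open>n\<close> on.\<close>

definition closed_disc :: "nat \<Rightarrow> (nat \<Rightarrow> real) set" where
  "closed_disc n = {x \<in> topspace (Euclidean_space n). (\<Sum>i<n. (x i)\<^sup>2) \<le> 1}"

definition open_disc :: "nat \<Rightarrow> (nat \<Rightarrow> real) set" where
  "open_disc n = {x \<in> topspace (Euclidean_space n). (\<Sum>i<n. (x i)\<^sup>2) < 1}"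

text \<open>\<open>cw_cells K q\<close> is the set of open \<open>q\<close>-cells. In particular a vertex is a 0-cell, that is, a
  one-element set of points.\<close>

record 'a cw =
  cw_space :: "'a topology"
  cw_cells :: "nat \<Rightarrow> 'a set set"

definition cell_closure :: "'a cw \<Rightarrow> 'a set \<Rightarrow> 'a set" where
  "cell_closure K e = cw_space K closure_of e"

definition cell_frontier :: "'a cw \<Rightarrow> 'a set \<Rightarrow> 'a set" where
  "cell_frontier K e = cell_closure K e - e"

text \<open>A characteristic map of a regular cell is a homeomorphism from the closed disc onto the closed
  cell. Closure-finiteness and the weak topology are automatic for finitely many cells.\<close>

definition regular_characteristic_map ::
    "'a cw \<Rightarrow> nat \<Rightarrow> 'a set \<Rightarrow> ((nat \<Rightarrow> real) \<Rightarrow> 'a) \<Rightarrow> bool" where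
  "regular_characteristic_map K q e \<Phi> \<longleftrightarrow>
     homeomorphic_map (subtopology (Euclidean_space q) (closed_disc q))
       (subtopology (cw_space K) (cell_closure K e)) \<Phi> \<and>
     \<Phi> ` open_disc q = e \<and>
     \<Phi> ` (closed_disc q - open_disc q) \<subseteq> (\<Union>r<q. \<Union>(cw_cells K r))"

definition finite_regular_CW :: "'a cw \<Rightarrow> bool" where
  "finite_regular_CW K \<longleftrightarrow>
     Hausdorff_space (cw_space K) \<and>
     finite (SIGMA q:UNIV. cw_cells K q) \<and>
     (\<Union>q. \<Union>(cw_cells K q)) = topspace (cw_space K) \<and>
     (\<forall>q r. \<forall>e\<in>cw_cells K q. \<forall>e'\<in>cw_cells K r. (q, e) \<noteq> (r, e') \<longrightarrow> e \<inter> e' = {}) \<and>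
     (\<forall>q. \<forall>e\<in>cw_cells K q. \<exists>\<Phi>. regular_characteristic_map K q e \<Phi>) \<and>
     (\<forall>q. \<forall>e\<in>cw_cells K q. \<exists>S \<subseteq> (\<Union>r. cw_cells K r). cell_frontier K e = \<Union>S)"

definition CW_dimension :: "'a cw \<Rightarrow> nat \<Rightarrow> bool" where
  "CW_dimension K n \<longleftrightarrow> cw_cells K n \<noteq> {} \<and> (\<forall>q>n. cw_cells K q = {})"

definition is_face :: "'a cw \<Rightarrow> 'a set \<Rightarrow> 'a set \<Rightarrow> bool" where
  "is_face K e e' \<longleftrightarrow> e \<subseteq> cell_closure K e'"

definition CW_pseudomanifold :: "nat \<Rightarrow> 'a cw \<Rightarrow> bool" where
  "CW_pseudomanifold n K \<longleftrightarrow>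
     finite_regular_CW K \<and> CW_dimension K n \<and>
     (\<forall>q. \<forall>e\<in>cw_cells K q. \<exists>f\<in>cw_cells K n. is_face K e f) \<and>
     (\<forall>m. Suc m = n \<longrightarrow> (\<forall>e\<in>cw_cells K m. card {f \<in> cw_cells K n. is_face K e f} \<le> 2)) \<and>
     (\<forall>a\<in>cw_cells K n. \<forall>b\<in>cw_cells K n. \<exists>es.
        es \<noteq> [] \<and> hd es = a \<and> last es = b \<and> set es \<subseteq> cw_cells K n \<and>
        successively (\<lambda>f g. \<exists>m. Suc m = n \<and> (\<exists>e\<in>cw_cells K m. is_face K e f \<and> is_face K e g)) es)"


section \<open>Polygonal faces and orientations\<close>

definition edge_joins :: "'a cw \<Rightarrow> 'a set \<Rightarrow> 'a set \<Rightarrow> 'a set \<Rightarrow> bool" where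
  "edge_joins K e u v \<longleftrightarrow>
     e \<in> cw_cells K 1 \<and> u \<in> cw_cells K 0 \<and> v \<in> cw_cells K 0 \<and> u \<noteq> v \<and> cell_frontier K e = u \<union> v"

text \<open>\<open>polygon K f vs es\<close>: the 2-cell \<open>f\<close> is a simple polygon with distinct vertices \<open>vs\<close> in cyclic
  order and edges \<open>es ! i\<close> from \<open>vs ! i\<close> to \<open>vs ! (i + 1)\<close>. The edges are listed as well because two
  vertices of a regular CW complex may be joined by several 1-cells.\<close>

definition polygon :: "'a cw \<Rightarrow> 'a set \<Rightarrow> 'a set list \<Rightarrow> 'a set list \<Rightarrow> bool" where
  "polygon K f vs es \<longleftrightarrow>
     f \<in> cw_cells K 2 \<and> 3 \<le> length vs \<and> length es = length vs \<and> distinct vs \<and>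
     (\<forall>i<length vs. edge_joins K (es ! i) (vs ! i) (vs ! ((i + 1) mod length vs))) \<and>
     cell_frontier K f = (\<Union>e\<in>set es. cell_closure K e)"

definition polygonal :: "'a cw \<Rightarrow> bool" where
  "polygonal K \<longleftrightarrow> (\<forall>f\<in>cw_cells K 2. \<exists>vs es. polygon K f vs es)"

text \<open>A choice of orientation for every edge and every face. A face is oriented by the cyclic order
  in which its vertices and edges are listed; the starting vertex is arbitrary.\<close>

record 'a orientation =
  tail :: "'a set \<Rightarrow> 'a set"
  head :: "'a set \<Rightarrow> 'a set"
  verts :: "'a set \<Rightarrow> 'a set list"
  edges :: "'a set \<Rightarrow> 'a set list"

definition orientation_of :: "'a cw \<Rightarrow> 'a orientation \<Rightarrow> bool" where
  "orientation_of K \<omega> \<longleftrightarrow>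
     (\<forall>e\<in>cw_cells K 1. edge_joins K e (tail \<omega> e) (head \<omega> e)) \<and>
     (\<forall>f\<in>cw_cells K 2. polygon K f (verts \<omega> f) (edges \<omega> f))"


section \<open>Chains, cochains and the exterior derivative\<close>

text \<open>The generator \<open>frag_of c\<close> stands for the cell \<open>c\<close> with its chosen orientation, and \<open>- frag_of c\<close>
  for the cell with the reversed one.\<close>

definition chain_group :: "'a cw \<Rightarrow> nat \<Rightarrow> ('a set \<Rightarrow>\<^sub>0 int) monoid" where
  "chain_group K q = free_Abelian_group (cw_cells K q)"

abbreviation chains :: "'a cw \<Rightarrow> nat \<Rightarrow> ('a set \<Rightarrow>\<^sub>0 int) set" where
  "chains K q \<equiv> carrier (chain_group K q)"

text \<open>The \<open>i\<close>-th oriented edge \<open>(v\<^sub>i, v\<^sub>i\<^sub>+\<^sub>1)\<close> of the oriented face \<open>f\<close>, as a 1-chain.\<close>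

definition face_edge :: "'a orientation \<Rightarrow> 'a set \<Rightarrow> nat \<Rightarrow> ('a set \<Rightarrow>\<^sub>0 int)" where
  "face_edge \<omega> f i =
     (if tail \<omega> (edges \<omega> f ! i) = verts \<omega> f ! i then frag_of (edges \<omega> f ! i)
      else - frag_of (edges \<omega> f ! i))"

definition boundary_cell :: "'a orientation \<Rightarrow> nat \<Rightarrow> 'a set \<Rightarrow> ('a set \<Rightarrow>\<^sub>0 int)" where
  "boundary_cell \<omega> q c =
     (if q = 1 then frag_of (head \<omega> c) - frag_of (tail \<omega> c)
      else if q = 2 then (\<Sum>i<length (verts \<omega> c). face_edge \<omega> c i)
      else 0)"

definition boundary :: "'a orientation \<Rightarrow> nat \<Rightarrow> ('a set \<Rightarrow>\<^sub>0 int) \<Rightarrow> ('a set \<Rightarrow>\<^sub>0 int)" where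
  "boundary \<omega> q = frag_extend (boundary_cell \<omega> q)"

definition real_additive_group :: "real monoid" where
  "real_additive_group = \<lparr>carrier = UNIV, monoid.mult = (+), one = 0\<rparr>"

type_synonym 'a cochain = "('a set \<Rightarrow>\<^sub>0 int) \<Rightarrow> real"

text \<open>Homomorphisms are made extensional so that equality of cochains is equality of functions.\<close>

definition cochains :: "'a cw \<Rightarrow> nat \<Rightarrow> 'a cochain set" where
  "cochains K q = hom (chain_group K q) real_additive_group \<inter> extensional (chains K q)"

definition cochain_add :: "'a cw \<Rightarrow> nat \<Rightarrow> 'a cochain \<Rightarrow> 'a cochain \<Rightarrow> 'a cochain" where
  "cochain_add K q \<alpha> \<beta> = (\<lambda>c\<in>chains K q. \<alpha> c + \<beta> c)"

definition cochain_zero :: "'a cw \<Rightarrow> nat \<Rightarrow> 'a cochain" where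
  "cochain_zero K q = (\<lambda>c\<in>chains K q. 0)"

definition ext_deriv :: "'a cw \<Rightarrow> 'a orientation \<Rightarrow> nat \<Rightarrow> 'a cochain \<Rightarrow> 'a cochain" where
  "ext_deriv K \<omega> q \<alpha> = (\<lambda>c\<in>chains K (Suc q). \<alpha> (boundary \<omega> (Suc q) c))"


section \<open>The polygonal cup product\<close>

definition cup_00 :: "'a cochain \<Rightarrow> 'a cochain \<Rightarrow> 'a set \<Rightarrow> real" where
  "cup_00 \<alpha> \<beta> v = \<alpha> (frag_of v) * \<beta> (frag_of v)"

definition cup_01 :: "'a orientation \<Rightarrow> 'a cochain \<Rightarrow> 'a cochain \<Rightarrow> 'a set \<Rightarrow> real" where
  "cup_01 \<omega> \<alpha> \<beta> e =
     1 / 2 * (\<alpha> (frag_of (tail \<omega> e)) + \<alpha> (frag_of (head \<omega> e))) * \<beta> (frag_of e)"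

definition cup_02 :: "'a orientation \<Rightarrow> 'a cochain \<Rightarrow> 'a cochain \<Rightarrow> 'a set \<Rightarrow> real" where
  "cup_02 \<omega> \<alpha> \<beta> f =
     (let p = length (verts \<omega> f)
      in 1 / real p * (\<Sum>i<p. \<alpha> (frag_of (verts \<omega> f ! i))) * \<beta> (frag_of f))"

text \<open>Since \<open>a \<le> p\<close> in the inner sum, \<open>i + (p - a)\<close> is \<open>i - a\<close> modulo \<open>p\<close>.\<close>

definition cup_11 :: "'a orientation \<Rightarrow> 'a cochain \<Rightarrow> 'a cochain \<Rightarrow> 'a set \<Rightarrow> real" where
  "cup_11 \<omega> \<alpha> \<beta> f =
     (let p = length (verts \<omega> f)
      in \<Sum>i<p. \<alpha> (face_edge \<omega> f i) *
           (\<Sum>a = 1..(p - 1) div 2. (1 / 2 - real a / real p) *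
              (\<beta> (face_edge \<omega> f ((i + a) mod p)) - \<beta> (face_edge \<omega> f ((i + (p - a)) mod p)))))"

definition cup_cell ::
    "'a orientation \<Rightarrow> nat \<Rightarrow> nat \<Rightarrow> 'a cochain \<Rightarrow> 'a cochain \<Rightarrow> 'a set \<Rightarrow> real" where
  "cup_cell \<omega> k l \<alpha> \<beta> c =
     (if (k, l) = (0, 0) then cup_00 \<alpha> \<beta> c
      else if (k, l) = (0, 1) then cup_01 \<omega> \<alpha> \<beta> c
      else if (k, l) = (1, 0) then cup_01 \<omega> \<beta> \<alpha> c
      else if (k, l) = (0, 2) then cup_02 \<omega> \<alpha> \<beta> c
      else if (k, l) = (2, 0) then cup_02 \<omega> \<beta> \<alpha> c
      else if (k, l) = (1, 1) then cup_11 \<omega> \<alpha> \<beta> c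
      else 0)"

text \<open>\<open>cup K \<omega> k l\<close> is the product of a \<open>k\<close>-form and an \<open>l\<close>-form, extended linearly from cells to
  chains.\<close>

definition cup ::
    "'a cw \<Rightarrow> 'a orientation \<Rightarrow> nat \<Rightarrow> nat \<Rightarrow> 'a cochain \<Rightarrow> 'a cochain \<Rightarrow> 'a cochain" where
  "cup K \<omega> k l \<alpha> \<beta> =
     (\<lambda>c\<in>chains K (k + l).
        \<Sum>x\<in>Poly_Mapping.keys c. real_of_int (Poly_Mapping.lookup c x) * cup_cell \<omega> k l \<alpha> \<beta> x)"

end

theory Submission
  imports Defs
begin

text \<open>
  Both sides of each identity are homomorphisms on chains, so they need only be compared on single
  cells (\<open>cochain_eqI\<close>). In total degree 3 there is nothing to compare, because 3-chains have zero
  boundary. On an edge the identity is the product rule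
  \<open>a'b' - ab = (b + b')(a' - a)/2 + (a + a')(b' - b)/2\<close>.

  The substance is the case of a 0-form \<open>\<alpha>\<close> and a 1-form \<open>\<beta>\<close> on a \<open>p\<close>-gon. Write \<open>A\<^sub>i\<close> for the
  value of \<open>\<alpha>\<close> at the \<open>i\<close>-th vertex and \<open>B\<^sub>i\<close> for that of \<open>\<beta>\<close> on the oriented edge from vertex \<open>i\<close> to
  vertex \<open>i + 1\<close>, indices modulo \<open>p\<close>. The weights \<open>1/2 - a/p\<close> of the cup product of 1-forms are
  odd under \<open>a \<mapsto> p - a\<close>, so its inner sum, folded over half of the polygon, is really a sum over
  all of it: \<open>S\<^sub>i = \<Sum>a=1..p-1. (1/2 - a/p) B\<^sub>i\<^sub>+\<^sub>a\<close> (\<open>sawtooth_sum_folded\<close>). This treats even and odd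
  \<open>p\<close> alike. The weight falls by \<open>1/p\<close> at every step around the polygon and jumps by 1 where the turn is
  completed, which gives \<open>S\<^sub>i - S\<^sub>i\<^sub>+\<^sub>1 = (B\<^sub>i + B\<^sub>i\<^sub>+\<^sub>1)/2 - (1/p) \<Sum>B\<close> (\<open>sawtooth_sum_diff\<close>).
  Cyclic summation by parts turns \<open>\<Sum>(A\<^sub>i\<^sub>+\<^sub>1 - A\<^sub>i) S\<^sub>i\<close>, the value of \<open>d\<alpha> \<union> \<beta>\<close>, into
  \<open>\<Sum>A\<^sub>i\<^sub>+\<^sub>1 (S\<^sub>i - S\<^sub>i\<^sub>+\<^sub>1)\<close>. The first part of the difference yields \<open>d(\<alpha> \<union> \<beta>)\<close>, and the mean value
  \<open>(1/p) \<Sum>B\<close> is exactly what \<open>\<alpha> \<union> d\<beta>\<close> compensates (\<open>cyclic_leibniz\<close>).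

  What the geometry contributes is that an edge determines its two end points, so that each edge of a
  face carries either the chosen orientation or the opposite one (\<open>face_edge_cases\<close>), and the values
  above have the expected signs.
\<close>

section \<open>Summation by parts around a polygon\<close>

lemma sum_cyclic_shift:
  fixes g :: "nat \<Rightarrow> 'b::comm_monoid_add"
  assumes "0 < p"
  shows "(\<Sum>i<p. g ((i + 1) mod p)) = (\<Sum>i<p. g i)"
proof -
  obtain q where p: "p = Suc q"
    using assms gr0_conv_Suc by blast
  have "(\<Sum>i<p. g ((i + 1) mod p)) = (\<Sum>i<q. g (Suc i)) + g 0"
    by (simp add: p)
  also have "\<dots> = (\<Sum>i<p. g i)"
    unfolding p by (simp only: sum.lessThan_Suc_shift add.commute)
  finally show ?thesis .
qed

lemma sum_cyclic_rotate:
  fixes g :: "nat \<Rightarrow> 'b::comm_monoid_add"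
  assumes "0 < p"
  shows "(\<Sum>a<p. g ((j + a) mod p)) = (\<Sum>a<p. g a)"
proof (induction j)
  case (Suc j)
  have "(\<Sum>a<p. g ((Suc j + a) mod p)) = (\<Sum>a<p. g ((j + (a + 1) mod p) mod p))"
    by (simp add: mod_simps)
  also have "\<dots> = (\<Sum>a<p. g ((j + a) mod p))"
    by (rule sum_cyclic_shift[OF assms, where g = "\<lambda>a. g ((j + a) mod p)"])
  finally show ?case
    using Suc by simp
qed simp

text \<open>
  Convolution of \<open>B\<close> with the discrete sawtooth \<open>1/2 - a/p\<close> on the cyclic group of order \<open>p\<close>. The
  sawtooth has its jump at \<open>a = 0\<close>; the mean value 0 of its one-sided limits \<open>\<plusminus>1/2\<close> is taken there,
  which is why the sum starts at 1.
\<close>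

definition sawtooth_sum :: "nat \<Rightarrow> (nat \<Rightarrow> real) \<Rightarrow> nat \<Rightarrow> real" where
  "sawtooth_sum p B i = (\<Sum>a = 1..<p. (1/2 - real a / real p) * B ((i + a) mod p))"

text \<open>
  The weights of \<open>a\<close> and \<open>p - a\<close> are opposite, so these two terms combine to a difference of values
  of \<open>B\<close>. For even \<open>p\<close> the index \<open>a = p/2\<close> has no partner, but its weight is zero.
\<close>

lemma sawtooth_sum_folded:
  "sawtooth_sum p B i =
     (\<Sum>a = 1..(p - 1) div 2. (1/2 - real a / real p) *
        (B ((i + a) mod p) - B ((i + (p - a)) mod p)))"
proof (cases "p = 0")
  case False
  define m where "m = (p - 1) div 2"
  define g where "g a = (1/2 - real a / real p) * B ((i + a) mod p)" for a
  have reflect: "g (p - a) = - (1/2 - real a / real p) * B ((i + (p - a)) mod p)"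
    if "a \<in> {1..m}" for a
  proof -
    have "a \<le> p"
      using that by (auto simp: m_def)
    then show ?thesis
      using False by (simp add: g_def of_nat_diff diff_divide_distrib)
  qed
  have middle: "g a = 0" if "a \<in> {1..<p} - ({1..m} \<union> (\<lambda>a. p - a) ` {1..m})" for a
  proof -
    have "a \<notin> (\<lambda>a. p - a) ` {1..m}"
      using that by blast
    then have "p - a \<notin> {1..m}"
      using that by (metis DiffD1 atLeastLessThan_iff diff_diff_cancel image_eqI less_imp_le)
    with that have "p = 2 * a"
      by (auto simp: m_def)
    then show ?thesis
      using False by (simp add: g_def)
  qed
  have "sawtooth_sum p B i = sum g ({1..m} \<union> (\<lambda>a. p - a) ` {1..m})"
    unfolding sawtooth_sum_def g_def[symmetric]
    using middle by (intro sum.mono_neutral_right) (auto simp: m_def)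
  also have "\<dots> = sum g {1..m} + sum g ((\<lambda>a. p - a) ` {1..m})"
    by (rule sum.union_disjoint) (auto simp: m_def)
  also have "sum g ((\<lambda>a. p - a) ` {1..m}) = (\<Sum>a = 1..m. g (p - a))"
    by (subst sum.reindex) (auto simp: inj_on_def m_def)
  also have "sum g {1..m} + (\<Sum>a = 1..m. g (p - a)) = (\<Sum>a = 1..m. g a + g (p - a))"
    by (simp only: sum.distrib)
  also have "\<dots> = (\<Sum>a = 1..m. (1/2 - real a / real p) *
                     (B ((i + a) mod p) - B ((i + (p - a)) mod p)))"
    by (rule sum.cong) (simp_all only: reflect, simp_all add: g_def algebra_simps)
  finally show ?thesis
    unfolding m_def .
qed (simp add: sawtooth_sum_def)

text \<open>
  Passing from \<open>j\<close> to \<open>j + 1\<close> shifts the weights by one place. If both sums are extended to the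
  whole polygon, with weight \<open>1/2\<close> at index 0 and \<open>-1/2\<close> at index \<open>p\<close>, all the weights differ by
  \<open>-1/p\<close>, which gives the sum over all of \<open>B\<close>. The two terms that are added in this way are the half
  values of \<open>B\<close> at \<open>j\<close> and \<open>j + 1\<close>.
\<close>

lemma sawtooth_sum_diff:
  assumes "0 < p"
  shows "sawtooth_sum p B j - sawtooth_sum p B (j + 1) =
           1/2 * (B (j mod p) + B ((j + 1) mod p)) - 1 / real p * (\<Sum>i<p. B i)"
proof -
  obtain q where p: "p = Suc q"
    using assms gr0_conv_Suc by blast
  define c where "c a = 1/2 - real a / real p" for a
  define b where "b a = B ((j + 1 + a) mod p)" for a
  have cp: "c p = - 1/2" and c0: "c 0 = 1/2"
    using assms by (simp_all add: c_def)
  have "j + 1 + q = j + p"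
    by (simp add: p)
  then have bq: "b q = B (j mod p)"
    by (simp only: b_def mod_add_self2)
  have step: "c (Suc a) - c a = - (1 / real p)" for a
    by (simp add: c_def diff_divide_distrib[symmetric] add_divide_distrib)
  \<comment> \<open>Both sums are written relative to the edge \<open>j + 1\<close>, so that only the weights differ.\<close>
  have "sawtooth_sum p B j = (\<Sum>a = Suc 0..<Suc q. c a * B ((j + a) mod p))"
    by (simp add: sawtooth_sum_def c_def p)
  also have "\<dots> = (\<Sum>a<q. c (Suc a) * b a)"
    by (simp only: sum.shift_bounds_Suc_ivl atLeast0LessThan b_def) simp
  also have "\<dots> = (\<Sum>a<p. c (Suc a) * b a) + 1/2 * b q"
    using cp by (simp add: p)
  finally have 1: "sawtooth_sum p B j = (\<Sum>a<p. c (Suc a) * b a) + 1/2 * b q" .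
  have "sawtooth_sum p B (j + 1) = (\<Sum>a = Suc 0..<p. c a * b a)"
    by (simp add: sawtooth_sum_def c_def b_def)
  moreover have "(\<Sum>a<p. c a * b a) = c 0 * b 0 + (\<Sum>a = Suc 0..<p. c a * b a)"
    using assms by (simp only: sum.atLeast_Suc_lessThan flip: atLeast0LessThan)
  ultimately have 2: "sawtooth_sum p B (j + 1) = (\<Sum>a<p. c a * b a) - 1/2 * b 0"
    using c0 by simp
  have "(\<Sum>a<p. c (Suc a) * b a) - (\<Sum>a<p. c a * b a) = (\<Sum>a<p. (c (Suc a) - c a) * b a)"
    by (simp add: sum_subtractf left_diff_distrib)
  also have "\<dots> = - (1 / real p) * (\<Sum>a<p. b a)"
    by (simp only: step sum_distrib_left)
  also have "(\<Sum>a<p. b a) = (\<Sum>a<p. B a)"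
    unfolding b_def by (rule sum_cyclic_rotate[OF assms])
  finally show ?thesis
    using 1 2 bq by (simp add: b_def algebra_simps)
qed

text \<open>
  Summation by parts has no boundary terms on a cycle. It moves the difference from \<open>A\<close> to the
  sawtooth sums, where it is known explicitly.
\<close>

lemma cyclic_leibniz:
  assumes "0 < p"
  shows "(\<Sum>i<p. 1/2 * (A i + A ((i + 1) mod p)) * B i) =
           (\<Sum>i<p. (A ((i + 1) mod p) - A i) * sawtooth_sum p B i) +
           1 / real p * (\<Sum>i<p. A i) * (\<Sum>i<p. B i)"
proof -
  let ?s = "\<lambda>i. (i + 1) mod p"
  let ?S = "sawtooth_sum p B"
  let ?b = "1 / real p * (\<Sum>i<p. B i)"
  have S_mod: "?S (?s i) = ?S (i + 1)" for i
    by (simp add: sawtooth_sum_def mod_simps)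
  have "(\<Sum>i<p. (A (?s i) - A i) * ?S i) = (\<Sum>i<p. A (?s i) * ?S i) - (\<Sum>i<p. A i * ?S i)"
    by (simp add: left_diff_distrib sum_subtractf)
  also have "(\<Sum>i<p. A i * ?S i) = (\<Sum>i<p. A (?s i) * ?S (i + 1))"
    using sum_cyclic_shift[OF assms, where g = "\<lambda>i. A i * ?S i"] by (simp only: S_mod)
  also have "(\<Sum>i<p. A (?s i) * ?S i) - (\<Sum>i<p. A (?s i) * ?S (i + 1)) =
      (\<Sum>i<p. A (?s i) * (?S i - ?S (i + 1)))"
    by (simp only: right_diff_distrib sum_subtractf)
  also have "\<dots> = (\<Sum>i<p. A (?s i) * (1/2 * (B i + B (?s i)) - ?b))"
    by (rule sum.cong) (simp_all only: sawtooth_sum_diff[OF assms], simp)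
  also have "\<dots> = (\<Sum>i<p. 1/2 * A (?s i) * B i) + (\<Sum>i<p. 1/2 * A (?s i) * B (?s i)) -
      (\<Sum>i<p. A (?s i) * ?b)"
    by (simp only: sum.distrib[symmetric] sum_subtractf[symmetric]) (simp add: algebra_simps)
  also have "(\<Sum>i<p. 1/2 * A (?s i) * B (?s i)) = (\<Sum>i<p. 1/2 * A i * B i)"
    by (rule sum_cyclic_shift[OF assms, where g = "\<lambda>i. 1/2 * A i * B i"])
  also have "(\<Sum>i<p. A (?s i) * ?b) = (\<Sum>i<p. A i) * ?b"
    using sum_cyclic_shift[OF assms, where g = A] by (simp only: sum_distrib_right[symmetric])
  finally show ?thesis
    by (simp add: algebra_simps sum.distrib)
qed

section \<open>Cochains as functions on cells\<close>

lemma chains_iff: "c \<in> chains K q \<longleftrightarrow> Poly_Mapping.keys c \<subseteq> cw_cells K q"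
  by (simp add: chain_group_def)

lemma frag_of_in_chains [simp]: "frag_of c \<in> chains K q \<longleftrightarrow> c \<in> cw_cells K q"
  by (simp add: chains_iff)

lemma zero_in_chains [simp]: "0 \<in> chains K q"
  by (simp add: chains_iff)

lemma minus_in_chains [simp]: "- c \<in> chains K q \<longleftrightarrow> c \<in> chains K q"
  by (simp add: chains_iff)

lemma add_in_chains: "c \<in> chains K q \<Longrightarrow> c' \<in> chains K q \<Longrightarrow> c + c' \<in> chains K q"
  using keys_add[of c c'] by (auto simp: chains_iff)

lemma diff_in_chains: "c \<in> chains K q \<Longrightarrow> c' \<in> chains K q \<Longrightarrow> c - c' \<in> chains K q"
  using keys_diff[of c c'] by (auto simp: chains_iff)

lemma sum_in_chains: "(\<And>i. i \<in> I \<Longrightarrow> c i \<in> chains K q) \<Longrightarrow> sum c I \<in> chains K q"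
  unfolding chain_group_def by (rule sum_closed_free_Abelian_group)

lemma cochains_restrictI:
  assumes "\<And>x y. x \<in> chains K q \<Longrightarrow> y \<in> chains K q \<Longrightarrow> F (x + y) = F x + F y"
  shows "(\<lambda>c\<in>chains K q. F c) \<in> cochains K q"
  using assms add_in_chains[of _ K q]
  by (auto simp: cochains_def hom_def real_additive_group_def chain_group_def)

lemma cochain_plus:
  assumes "\<alpha> \<in> cochains K q" "x \<in> chains K q" "y \<in> chains K q"
  shows "\<alpha> (x + y) = \<alpha> x + \<alpha> y"
  using assms by (auto simp: cochains_def hom_def real_additive_group_def chain_group_def)

lemma cochain_0: "\<alpha> \<in> cochains K q \<Longrightarrow> \<alpha> 0 = 0"
  using cochain_plus[of \<alpha> K q 0 0] by simp

lemma cochain_minus: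
  assumes "\<alpha> \<in> cochains K q" "x \<in> chains K q"
  shows "\<alpha> (- x) = - \<alpha> x"
  using cochain_plus[OF assms, of "- x"] cochain_0[OF assms(1)] assms(2) by simp

lemma cochain_diff:
  assumes "\<alpha> \<in> cochains K q" "x \<in> chains K q" "y \<in> chains K q"
  shows "\<alpha> (x - y) = \<alpha> x - \<alpha> y"
  using cochain_plus[OF assms(1,2), of "- y"] cochain_minus[OF assms(1,3)] assms(3) by simp

lemma cochain_sum:
  assumes "\<alpha> \<in> cochains K q" "\<And>i. i \<in> I \<Longrightarrow> c i \<in> chains K q"
  shows "\<alpha> (sum c I) = (\<Sum>i\<in>I. \<alpha> (c i))"
  using assms(2)
proof (induction I rule: infinite_finite_induct)
  case (insert i I)
  then show ?case
    using cochain_plus[OF assms(1), of "c i" "sum c I"] sum_in_chains[of I c] by simp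
qed (use cochain_0[OF assms(1)] in simp_all)

text \<open>
  The cells freely generate the chains, and extensionality removes any freedom outside the chains.
\<close>

lemma cochain_eqI:
  assumes "\<alpha> \<in> cochains K q" "\<beta> \<in> cochains K q"
    and cells: "\<And>c. c \<in> cw_cells K q \<Longrightarrow> \<alpha> (frag_of c) = \<beta> (frag_of c)"
  shows "\<alpha> = \<beta>"
proof (rule extensionalityI)
  show "\<alpha> \<in> extensional (chains K q)" "\<beta> \<in> extensional (chains K q)"
    using assms by (simp_all add: cochains_def)
  show "\<alpha> x = \<beta> x" if "x \<in> chains K q" for x
  proof (rule free_Abelian_group_induct[where S = "cw_cells K q" and x = x])
    show "Poly_Mapping.keys x \<subseteq> cw_cells K q"
      using that by (simp add: chains_iff)
  qed (use assms in \<open>simp_all add: cochain_0 cochain_diff chains_iff\<close>)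
qed

lemma cochain_add_in_cochains:
  assumes "\<alpha> \<in> cochains K q" "\<beta> \<in> cochains K q"
  shows "cochain_add K q \<alpha> \<beta> \<in> cochains K q"
  unfolding cochain_add_def
  by (rule cochains_restrictI) (simp add: cochain_plus[OF assms(1)] cochain_plus[OF assms(2)])

lemma cup_in_cochains: "cup K \<omega> k l \<alpha> \<beta> \<in> cochains K (k + l)"
  unfolding cup_def
proof (rule cochains_restrictI)
  fix x y :: "'a set \<Rightarrow>\<^sub>0 int"
  let ?g = "\<lambda>z c. real_of_int (Poly_Mapping.lookup z c) * cup_cell \<omega> k l \<alpha> \<beta> c"
  let ?U = "Poly_Mapping.keys x \<union> Poly_Mapping.keys y"
  \<comment> \<open>Cancellation may shrink the support of \<open>x + y\<close>, so all three sums are taken over a common set.\<close>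
  have extend: "sum (?g z) (Poly_Mapping.keys z) = sum (?g z) ?U"
    if "Poly_Mapping.keys z \<subseteq> ?U" for z
    using that by (intro sum.mono_neutral_left) (auto simp: in_keys_iff)
  have "sum (?g (x + y)) ?U = sum (?g x) ?U + sum (?g y) ?U"
    by (simp add: lookup_add distrib_right sum.distrib)
  then show "sum (?g (x + y)) (Poly_Mapping.keys (x + y)) =
      sum (?g x) (Poly_Mapping.keys x) + sum (?g y) (Poly_Mapping.keys y)"
    using extend[of x] extend[of y] extend[OF keys_add] by simp
qed

lemma cup_frag_of:
  "c \<in> cw_cells K (k + l) \<Longrightarrow> cup K \<omega> k l \<alpha> \<beta> (frag_of c) = cup_cell \<omega> k l \<alpha> \<beta> c"
  by (simp add: cup_def)

section \<open>Oriented edges of oriented cells\<close>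

text \<open>The open disc of dimension 0 is a point, not the empty set.\<close>

lemma zero_cell_nonempty:
  assumes "finite_regular_CW K" "v \<in> cw_cells K 0"
  shows "v \<noteq> {}"
proof -
  have "\<forall>q. \<forall>e\<in>cw_cells K q. \<exists>\<Phi>. regular_characteristic_map K q e \<Phi>"
    using assms(1) unfolding finite_regular_CW_def by (elim conjE) assumption
  then obtain \<Phi> where "regular_characteristic_map K 0 v \<Phi>"
    using assms(2) by blast
  moreover have "(\<lambda>i. 0) \<in> open_disc 0"
    by (simp add: open_disc_def topspace_Euclidean_space)
  ultimately show ?thesis
    unfolding regular_characteristic_map_def by blast
qed

text \<open>
  The frontier of an edge is only known as a union of two 0-cells. The cells can be recovered from the
  union because distinct 0-cells are disjoint and none of them is empty.
\<close>

lemma edge_joins_unique: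
  assumes K: "finite_regular_CW K"
    and "edge_joins K e u v" "edge_joins K e u' v'"
  shows "u = u' \<and> v = v' \<or> u = v' \<and> v = u'"
proof -
  have cells: "u \<in> cw_cells K 0" "v \<in> cw_cells K 0" "u' \<in> cw_cells K 0" "v' \<in> cw_cells K 0"
    and ne: "u \<noteq> v" "u' \<noteq> v'" and eq: "u \<union> v = u' \<union> v'"
    using assms(2,3) by (auto simp: edge_joins_def)
  have disjoint: "\<forall>q r. \<forall>e\<in>cw_cells K q. \<forall>e'\<in>cw_cells K r. (q, e) \<noteq> (r, e') \<longrightarrow> e \<inter> e' = {}"
    using K unfolding finite_regular_CW_def by (elim conjE) assumption
  have disj: "x \<inter> y = {}" if "x \<in> cw_cells K 0" "y \<in> cw_cells K 0" "x \<noteq> y" for x y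
    using disjoint[rule_format, OF that(1,2)] that(3) by simp
  have in_pair: "x = y \<or> x = z"
    if "x \<in> cw_cells K 0" "y \<in> cw_cells K 0" "z \<in> cw_cells K 0" "x \<subseteq> y \<union> z" for x y z
    using disj[OF that(1,2)] disj[OF that(1,3)] zero_cell_nonempty[OF K that(1)] that(4) by blast
  have "u \<subseteq> u' \<union> v'" "v \<subseteq> u' \<union> v'"
    using eq by blast+
  then have "u = u' \<or> u = v'" "v = u' \<or> v = v'"
    using in_pair cells by metis+
  with ne show ?thesis
    by auto
qed

lemma orientation_of_edge:
  assumes "orientation_of K \<omega>" "e \<in> cw_cells K 1"
  shows "edge_joins K e (tail \<omega> e) (head \<omega> e)"
  using assms by (simp add: orientation_of_def)

lemma orientation_of_face:
  assumes "orientation_of K \<omega>" "f \<in> cw_cells K 2"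
  shows "polygon K f (verts \<omega> f) (edges \<omega> f)"
  using assms by (simp add: orientation_of_def)

lemma polygon_verts_pos: "polygon K f vs es \<Longrightarrow> 0 < length vs"
  by (auto simp: polygon_def)

lemma polygon_edge:
  assumes "polygon K f vs es" "i < length vs"
  shows "edge_joins K (es ! i) (vs ! i) (vs ! ((i + 1) mod length vs))"
  using assms by (simp add: polygon_def)

text \<open>
  The sign in \<open>face_edge\<close> is chosen by looking at the tail only. Since the end points of an edge are
  unique, the head is then at the other vertex, and a negative sign does mean the reversed edge.
\<close>

lemma face_edge_cases:
  assumes K: "finite_regular_CW K" and \<omega>: "orientation_of K \<omega>" and f: "f \<in> cw_cells K 2"
    and i: "i < length (verts \<omega> f)"
  defines "e \<equiv> edges \<omega> f ! i" and "u \<equiv> verts \<omega> f ! i"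
    and "v \<equiv> verts \<omega> f ! ((i + 1) mod length (verts \<omega> f))"
  obtains (same) "e \<in> cw_cells K 1" "face_edge \<omega> f i = frag_of e" "tail \<omega> e = u" "head \<omega> e = v"
    | (reversed) "e \<in> cw_cells K 1" "face_edge \<omega> f i = - frag_of e" "tail \<omega> e = v" "head \<omega> e = u"
proof -
  have joins: "edge_joins K e u v"
    unfolding e_def u_def v_def by (rule polygon_edge[OF orientation_of_face[OF \<omega> f] i])
  then have e: "e \<in> cw_cells K 1" and "u \<noteq> v"
    by (auto simp: edge_joins_def)
  have "tail \<omega> e = u \<and> head \<omega> e = v \<or> tail \<omega> e = v \<and> head \<omega> e = u"
    using edge_joins_unique[OF K orientation_of_edge[OF \<omega> e] joins] .
  then show thesis
    using e \<open>u \<noteq> v\<close> same reversed unfolding face_edge_def e_def u_def v_def by auto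
qed

lemma face_edge_in_chains:
  assumes "orientation_of K \<omega>" "f \<in> cw_cells K 2" "i < length (verts \<omega> f)"
  shows "face_edge \<omega> f i \<in> chains K 1"
  using polygon_edge[OF orientation_of_face[OF assms(1,2)] assms(3)]
  by (simp add: face_edge_def edge_joins_def)

lemma edge_ends:
  assumes "orientation_of K \<omega>" "e \<in> cw_cells K 1"
  shows "tail \<omega> e \<in> cw_cells K 0" "head \<omega> e \<in> cw_cells K 0"
  using orientation_of_edge[OF assms] by (auto simp: edge_joins_def)

text \<open>
  Cochains are additive on chains only. The boundary must therefore be known to be a chain before
  a cochain can be evaluated on it term by term.
\<close>

lemma boundary_cell_in_chains:
  assumes "orientation_of K \<omega>" "c \<in> cw_cells K (Suc q)"
  shows "boundary_cell \<omega> (Suc q) c \<in> chains K q"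
proof -
  consider "q = 0" | "q = 1" | "q \<ge> 2"
    by linarith
  then show ?thesis
  proof cases
    case 1
    then show ?thesis
      using edge_ends[OF assms(1), of c] assms(2)
      by (auto simp: boundary_cell_def intro!: diff_in_chains)
  next
    case 2
    then show ?thesis
      using face_edge_in_chains[OF assms(1), of c] assms(2)
      by (auto simp: boundary_cell_def numeral_2_eq_2 intro!: sum_in_chains)
  qed (simp add: boundary_cell_def)
qed

lemma boundary_in_chains:
  assumes "orientation_of K \<omega>" "c \<in> chains K (Suc q)"
  shows "boundary \<omega> (Suc q) c \<in> chains K q"
proof -
  have "Poly_Mapping.keys (boundary \<omega> (Suc q) c) \<subseteq>
      (\<Union>x\<in>Poly_Mapping.keys c. Poly_Mapping.keys (boundary_cell \<omega> (Suc q) x))"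
    unfolding boundary_def by (rule keys_frag_extend)
  then show ?thesis
    using boundary_cell_in_chains[OF assms(1)] assms(2) by (fastforce simp: chains_iff)
qed

lemma ext_deriv_in_cochains:
  assumes "orientation_of K \<omega>" "\<alpha> \<in> cochains K q"
  shows "ext_deriv K \<omega> q \<alpha> \<in> cochains K (Suc q)"
  unfolding ext_deriv_def
proof (rule cochains_restrictI)
  fix x y assume "x \<in> chains K (Suc q)" "y \<in> chains K (Suc q)"
  then show "\<alpha> (boundary \<omega> (Suc q) (x + y)) =
      \<alpha> (boundary \<omega> (Suc q) x) + \<alpha> (boundary \<omega> (Suc q) y)"
    using cochain_plus[OF assms(2) boundary_in_chains[OF assms(1)] boundary_in_chains[OF assms(1)]]
    by (simp add: boundary_def frag_extend_add)
qed

lemma ext_deriv_frag_of: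
  "c \<in> cw_cells K (Suc q) \<Longrightarrow> ext_deriv K \<omega> q \<alpha> (frag_of c) = \<alpha> (boundary_cell \<omega> (Suc q) c)"
  by (simp add: ext_deriv_def boundary_def)

lemma ext_deriv_edge:
  assumes "orientation_of K \<omega>" "\<alpha> \<in> cochains K 0" "e \<in> cw_cells K 1"
  shows "ext_deriv K \<omega> 0 \<alpha> (frag_of e) = \<alpha> (frag_of (head \<omega> e)) - \<alpha> (frag_of (tail \<omega> e))"
  using assms(3) edge_ends[OF assms(1,3)]
  by (simp add: ext_deriv_frag_of boundary_cell_def cochain_diff[OF assms(2)])

lemma ext_deriv_face:
  assumes "orientation_of K \<omega>" "\<alpha> \<in> cochains K 1" "f \<in> cw_cells K 2"
  shows "ext_deriv K \<omega> 1 \<alpha> (frag_of f) = (\<Sum>i<length (verts \<omega> f). \<alpha> (face_edge \<omega> f i))"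
proof -
  have "ext_deriv K \<omega> 1 \<alpha> (frag_of f) = \<alpha> (\<Sum>i<length (verts \<omega> f). face_edge \<omega> f i)"
    using assms(3) by (simp add: ext_deriv_def boundary_def boundary_cell_def numeral_2_eq_2)
  also have "\<dots> = (\<Sum>i<length (verts \<omega> f). \<alpha> (face_edge \<omega> f i))"
    using face_edge_in_chains[OF assms(1,3)] by (intro cochain_sum[OF assms(2)]) simp
  finally show ?thesis .
qed

text \<open>
  Along the boundary of a face, the derivative of a 0-form is the difference of consecutive vertex
  values, whatever orientations the edges were given: reversal changes both signs.
\<close>

lemma ext_deriv_face_edge:
  assumes "finite_regular_CW K" "orientation_of K \<omega>" "\<alpha> \<in> cochains K 0"
    and "f \<in> cw_cells K 2" "i < length (verts \<omega> f)"
  shows "ext_deriv K \<omega> 0 \<alpha> (face_edge \<omega> f i) =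
    \<alpha> (frag_of (verts \<omega> f ! ((i + 1) mod length (verts \<omega> f)))) - \<alpha> (frag_of (verts \<omega> f ! i))"
proof -
  note d = ext_deriv_in_cochains[OF assms(2,3)]
  show ?thesis
    using assms(1,2,4,5)
  proof (cases rule: face_edge_cases)
    case same
    then show ?thesis
      by (simp add: ext_deriv_edge[OF assms(2,3)])
  next
    case reversed
    then show ?thesis
      using cochain_minus[OF d, of "frag_of (edges \<omega> f ! i)"]
      by (simp add: ext_deriv_edge[OF assms(2,3)])
  qed
qed

text \<open>
  The coefficient of \<open>\<beta>\<close> is the mean of the two end values, which reversal of the edge does not
  affect; so the defining formula is valid for the edges as oriented by the face as well.
\<close>

lemma cup_01_face_edge:
  assumes "finite_regular_CW K" "orientation_of K \<omega>" "\<beta> \<in> cochains K 1"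
    and "f \<in> cw_cells K 2" "i < length (verts \<omega> f)"
  shows "cup K \<omega> 0 1 \<alpha> \<beta> (face_edge \<omega> f i) =
    1/2 * (\<alpha> (frag_of (verts \<omega> f ! i)) +
           \<alpha> (frag_of (verts \<omega> f ! ((i + 1) mod length (verts \<omega> f))))) * \<beta> (face_edge \<omega> f i)"
proof -
  have cup: "cup K \<omega> 0 1 \<alpha> \<beta> \<in> cochains K 1"
    using cup_in_cochains[of K \<omega> 0 1] by simp
  have on_edge: "cup K \<omega> 0 1 \<alpha> \<beta> (frag_of e) = cup_01 \<omega> \<alpha> \<beta> e" if "e \<in> cw_cells K 1" for e
    using that by (simp add: cup_frag_of cup_cell_def)
  show ?thesis
    using assms(1,2,4,5)
  proof (cases rule: face_edge_cases)
    case same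
    then show ?thesis
      by (simp only: on_edge cup_01_def)
  next
    case reversed
    then show ?thesis
      by (simp only: cochain_minus[OF cup] cochain_minus[OF assms(3)] frag_of_in_chains
          on_edge cup_01_def) (simp add: add.commute)
  qed
qed

section \<open>The Leibniz rule\<close>

lemma leibniz_00:
  assumes \<omega>: "orientation_of K \<omega>" and \<alpha>: "\<alpha> \<in> cochains K 0" and \<beta>: "\<beta> \<in> cochains K 0"
  shows "ext_deriv K \<omega> 0 (cup K \<omega> 0 0 \<alpha> \<beta>) =
    cochain_add K 1 (cup K \<omega> 1 0 (ext_deriv K \<omega> 0 \<alpha>) \<beta>) (cup K \<omega> 0 1 \<alpha> (ext_deriv K \<omega> 0 \<beta>))"
    (is "?L = ?R")
proof (rule cochain_eqI[where q = 1 and K = K])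
  have cup00: "cup K \<omega> 0 0 \<alpha> \<beta> \<in> cochains K 0"
    using cup_in_cochains[of K \<omega> 0 0] by simp
  show "?L \<in> cochains K 1"
    using ext_deriv_in_cochains[OF \<omega> cup00] by simp
  show "?R \<in> cochains K 1"
    using cup_in_cochains[of K \<omega> 1 0] cup_in_cochains[of K \<omega> 0 1]
    by (intro cochain_add_in_cochains) simp_all
  fix e assume e: "e \<in> cw_cells K 1"
  define a a' b b' where "a = \<alpha> (frag_of (tail \<omega> e))" and "a' = \<alpha> (frag_of (head \<omega> e))"
    and "b = \<beta> (frag_of (tail \<omega> e))" and "b' = \<beta> (frag_of (head \<omega> e))"
  have "?L (frag_of e) = a' * b' - a * b"
    using ext_deriv_edge[OF \<omega> cup00 e] edge_ends[OF \<omega> e]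
    by (simp add: cup_frag_of cup_cell_def cup_00_def a_def a'_def b_def b'_def)
  also have "\<dots> = 1/2 * (b + b') * (a' - a) + 1/2 * (a + a') * (b' - b)"
    by (simp add: field_simps)
  also have "\<dots> = ?R (frag_of e)"
    using e ext_deriv_edge[OF \<omega> \<alpha> e] ext_deriv_edge[OF \<omega> \<beta> e]
    by (simp add: cochain_add_def cup_frag_of cup_cell_def cup_01_def a_def a'_def b_def b'_def)
  finally show "?L (frag_of e) = ?R (frag_of e)" .
qed

lemma cup_11_sawtooth:
  "cup_11 \<omega> \<alpha> \<beta> f = (\<Sum>i<length (verts \<omega> f). \<alpha> (face_edge \<omega> f i) *
     sawtooth_sum (length (verts \<omega> f)) (\<lambda>j. \<beta> (face_edge \<omega> f j)) i)"
  by (simp only: cup_11_def Let_def sawtooth_sum_folded)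

text \<open>
  In terms of vertex values and oriented edge values around one face, this is \<open>cyclic_leibniz\<close>.
\<close>

lemma leibniz_01:
  assumes K: "finite_regular_CW K" and \<omega>: "orientation_of K \<omega>"
    and \<alpha>: "\<alpha> \<in> cochains K 0" and \<beta>: "\<beta> \<in> cochains K 1"
  shows "ext_deriv K \<omega> 1 (cup K \<omega> 0 1 \<alpha> \<beta>) =
    cochain_add K 2 (cup K \<omega> 1 1 (ext_deriv K \<omega> 0 \<alpha>) \<beta>) (cup K \<omega> 0 2 \<alpha> (ext_deriv K \<omega> 1 \<beta>))"
    (is "?L = ?R")
proof (rule cochain_eqI[where q = 2 and K = K])
  have cup01: "cup K \<omega> 0 1 \<alpha> \<beta> \<in> cochains K 1"
    using cup_in_cochains[of K \<omega> 0 1] by simp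
  show "?L \<in> cochains K 2"
    using ext_deriv_in_cochains[OF \<omega> cup01] by (simp add: numeral_2_eq_2)
  have "cup K \<omega> 1 1 (ext_deriv K \<omega> 0 \<alpha>) \<beta> \<in> cochains K 2"
    using cup_in_cochains[of K \<omega> 1 1] by (simp add: numeral_2_eq_2)
  moreover have "cup K \<omega> 0 2 \<alpha> (ext_deriv K \<omega> 1 \<beta>) \<in> cochains K 2"
    using cup_in_cochains[of K \<omega> 0 2] by (simp only: add_0)
  ultimately show "?R \<in> cochains K 2"
    by (rule cochain_add_in_cochains)
  fix f assume f: "f \<in> cw_cells K 2"
  define p where "p = length (verts \<omega> f)"
  define A where "A i = \<alpha> (frag_of (verts \<omega> f ! i))" for i
  define B where "B i = \<beta> (face_edge \<omega> f i)" for i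
  have p: "0 < p"
    unfolding p_def by (rule polygon_verts_pos[OF orientation_of_face[OF \<omega> f]])
  have dA: "ext_deriv K \<omega> 0 \<alpha> (face_edge \<omega> f i) = A ((i + 1) mod p) - A i" if "i < p" for i
    using ext_deriv_face_edge[OF K \<omega> \<alpha> f] that by (simp add: A_def p_def)
  have "?L (frag_of f) = (\<Sum>i<p. cup K \<omega> 0 1 \<alpha> \<beta> (face_edge \<omega> f i))"
    using ext_deriv_face[OF \<omega> cup01 f] by (simp add: p_def)
  also have "\<dots> = (\<Sum>i<p. 1/2 * (A i + A ((i + 1) mod p)) * B i)"
    using cup_01_face_edge[OF K \<omega> \<beta> f] by (intro sum.cong) (simp_all add: A_def B_def p_def)
  also have "\<dots> = (\<Sum>i<p. (A ((i + 1) mod p) - A i) * sawtooth_sum p B i) +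
      1 / real p * (\<Sum>i<p. A i) * (\<Sum>i<p. B i)"
    by (rule cyclic_leibniz[OF p])
  also have "(\<Sum>i<p. (A ((i + 1) mod p) - A i) * sawtooth_sum p B i) =
      cup_11 \<omega> (ext_deriv K \<omega> 0 \<alpha>) \<beta> f"
    using dA by (simp add: cup_11_sawtooth B_def[abs_def] p_def)
  also have "1 / real p * (\<Sum>i<p. A i) * (\<Sum>i<p. B i) = cup_02 \<omega> \<alpha> (ext_deriv K \<omega> 1 \<beta>) f"
    using ext_deriv_face[OF \<omega> \<beta> f] by (simp add: cup_02_def Let_def A_def B_def p_def)
  finally show "?L (frag_of f) = ?R (frag_of f)"
    using f by (simp add: cochain_add_def cup_frag_of cup_cell_def numeral_2_eq_2)
qed

lemma ext_deriv_degree_2: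
  assumes "\<alpha> \<in> cochains K 2"
  shows "ext_deriv K \<omega> 2 \<alpha> = cochain_zero K 3"
proof -
  have "boundary \<omega> 3 c = 0" for c
    by (simp add: boundary_def boundary_cell_def frag_extend_def)
  then show ?thesis
    using cochain_0[OF assms]
    by (simp add: ext_deriv_def cochain_zero_def numeral_3_eq_3 numeral_2_eq_2)
qed

theorem lemma4p1:
  fixes K :: "'a cw" and \<omega> :: "'a orientation"
  assumes "CW_pseudomanifold 2 K"
    and "polygonal K"
    and "orientation_of K \<omega>"
  shows "(\<forall>\<alpha>\<in>cochains K 0. \<forall>\<beta>\<in>cochains K 0.
            ext_deriv K \<omega> 0 (cup K \<omega> 0 0 \<alpha> \<beta>) =
            cochain_add K 1 (cup K \<omega> 1 0 (ext_deriv K \<omega> 0 \<alpha>) \<beta>)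
                            (cup K \<omega> 0 1 \<alpha> (ext_deriv K \<omega> 0 \<beta>))) \<and>
         (\<forall>\<alpha>\<in>cochains K 0. \<forall>\<beta>\<in>cochains K 1.
            ext_deriv K \<omega> 1 (cup K \<omega> 0 1 \<alpha> \<beta>) =
            cochain_add K 2 (cup K \<omega> 1 1 (ext_deriv K \<omega> 0 \<alpha>) \<beta>)
                            (cup K \<omega> 0 2 \<alpha> (ext_deriv K \<omega> 1 \<beta>))) \<and>
         (\<forall>\<alpha>\<in>cochains K 0. \<forall>\<beta>\<in>cochains K 2.
            ext_deriv K \<omega> 2 (cup K \<omega> 0 2 \<alpha> \<beta>) = cochain_zero K 3) \<and>
         (\<forall>\<alpha>\<in>cochains K 1. \<forall>\<beta>\<in>cochains K 1.
            ext_deriv K \<omega> 2 (cup K \<omega> 1 1 \<alpha> \<beta>) = cochain_zero K 3)"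
proof (intro conjI ballI)
  have K: "finite_regular_CW K"
    using assms(1) by (simp add: CW_pseudomanifold_def)
  fix \<alpha> \<beta> :: "'a cochain"
  show "ext_deriv K \<omega> 0 (cup K \<omega> 0 0 \<alpha> \<beta>) =
      cochain_add K 1 (cup K \<omega> 1 0 (ext_deriv K \<omega> 0 \<alpha>) \<beta>) (cup K \<omega> 0 1 \<alpha> (ext_deriv K \<omega> 0 \<beta>))"
    if "\<alpha> \<in> cochains K 0" "\<beta> \<in> cochains K 0"
    using leibniz_00[OF assms(3) that] .
  show "ext_deriv K \<omega> 1 (cup K \<omega> 0 1 \<alpha> \<beta>) =
      cochain_add K 2 (cup K \<omega> 1 1 (ext_deriv K \<omega> 0 \<alpha>) \<beta>) (cup K \<omega> 0 2 \<alpha> (ext_deriv K \<omega> 1 \<beta>))"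
    if "\<alpha> \<in> cochains K 0" "\<beta> \<in> cochains K 1"
    using leibniz_01[OF K assms(3) that] .
  show "ext_deriv K \<omega> 2 (cup K \<omega> 0 2 \<alpha> \<beta>) = cochain_zero K 3"
    using cup_in_cochains[of K \<omega> 0 2] by (intro ext_deriv_degree_2) (simp only: add_0)
  show "ext_deriv K \<omega> 2 (cup K \<omega> 1 1 \<alpha> \<beta>) = cochain_zero K 3"
    using cup_in_cochains[of K \<omega> 1 1] by (intro ext_deriv_degree_2) (simp add: numeral_2_eq_2)
qed

end
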